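(* Let $r,p,q$ be positive integers and let $\mathbf d\in\Lambda^J=\Lambda^J_{r,p,q}$. Then $\mathbf d$ is of finite type in $\mathscr D$ if and only if $\mathbf d$ is of finite type in $\mathscr J$.
   Context: The base field $\Bbbk$ is algebraically closed of characteristic zero. A "partition" is a finite sequence $\mathbf a=(a_1,\dots,a_p)$ of non-negative integers (zero parts allowed, no ordering required); $|\mathbf a|=a_1+\cdots+a_p$, $\mathbf a'=(a_1,\dots,a_{p-1})$, $\ell(\mathbf a)=p$. $\mathrm{Fl}_{\mathbf a}(V)$ is the variety of flags $0=A_0\subset A_1\subset\cdots\subset A_p=V$ with $\dim A_i-\dim A_{i-1}=a_i$ for $i=1,\dots,p$ (so $\dim V=|\mathbf a|$). $\Lambda^J=\Lambda^J_{r,p,q}$ is the additive semigroup of all triples $(\mathbf a,\mathbf b,\mathbf c)$ of partitions with $(\ell(\mathbf a),\ell(\mathbf b),\ell(\mathbf c))=(r,p,q)$, $|\mathbf a|=|\mathbf b|=|\mathbf c|$ and $|\mathbf a|=|\mathbf b'|+|\mathbf c'|$. For $\mathbf d=(\mathbf a,\mathbf b,\mathbf c)\in\Lambda^J$ and $V$ a $\Bbbk$-vector space of dimension $|\mathbf a|$, the joint flag variety $\mathrm{Jl}_{\mathbf d}(V)$ is the subvariety of $\mathrm{Fl}_{\mathbf a}(V)\times\mathrm{Fl}_{\mathbf b}(V)\times\mathrm{Fl}_{\mathbf c}(V)$ of triples $(A,B,C)$ with $B_{p-1}\oplus C_{q-1}=V$. $\mathbf d$ is of finite type in $\mathscr J$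 if the number of orbits of the diagonal action of $GL(V)$ on $\mathrm{Jl}_{\mathbf d}(V)$ is finite. For $\mathbf d=(\mathbf a,\mathbf b,\mathbf c)\in\Lambda^J$ write $\mathbf b=(\mathbf b',b_p)$, $\mathbf c=(\mathbf c',c_q)$; let $V_2,V_3$ be $\Bbbk$-vector spaces with $\dim V_2=c_q\,(=|\mathbf b'|)$, $\dim V_3=b_p\,(=|\mathbf c'|)$, and $V_1=V_2\oplus V_3$. The double flag variety is $\mathrm{Dl}_{\mathbf d}(V_2\oplus V_3)=\mathrm{Fl}_{\mathbf a}(V_1)\times\mathrm{Fl}_{\mathbf b'}(V_2)\times\mathrm{Fl}_{\mathbf c'}(V_3)$, with the diagonal action of $GL(V_2)\times GL(V_3)$ (acting on the first factor as a subgroup of $GL(V_1)$). $\mathbf d$ is of finite type in $\mathscr D$ if the number of $GL(V_2)\times GL(V_3)$-orbits in $\mathrm{Dl}_{\mathbf d}(V_2\oplus V_3)$ is finite. *)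

theory Defs
  imports
    "HOL-Computational_Algebra.Polynomial"
    "HOL-Analysis.Product_Vector"
    "HOL-Algebra.Group_Action"
begin

definition vector_space_of_dim ::
    "('k::field \<Rightarrow> 'v::ab_group_add \<Rightarrow> 'v) \<Rightarrow> nat \<Rightarrow> bool" where
  "vector_space_of_dim s n \<longleftrightarrow>
     (\<exists>B. finite_dimensional_vector_space s B \<and> card B = n)"

definition GL ::
    "('k::field \<Rightarrow> 'v::ab_group_add \<Rightarrow> 'v) \<Rightarrow> ('v \<Rightarrow> 'v) monoid" where
  "GL s = \<lparr>carrier = {g. Vector_Spaces.linear s s g \<and> bij g}, mult = (\<circ>), one = id\<rparr>"

text \<open>
  A flag \<open>0 = A\<^sub>0 \<subseteq> A\<^sub>1 \<subseteq> \<dots> \<subseteq> A\<^sub>p = V\<close> is the list \<open>[A\<^sub>0, \<dots>, A\<^sub>p]\<close>, so \<open>A\<^sub>i = A ! i\<close>, while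
  the part \<open>a\<^sub>i\<close> of a partition is \<open>a ! (i - 1)\<close>. Parts may be zero, so the inclusions
  need not be strict. The ambient space \<open>V\<close> is always the whole type.
\<close>

definition Fl ::
    "('k::field \<Rightarrow> 'v::ab_group_add \<Rightarrow> 'v) \<Rightarrow> nat list \<Rightarrow> 'v set list set" where
  "Fl s a = {A. length A = length a + 1
      \<and> (\<forall>i \<le> length a. module.subspace s (A ! i))
      \<and> A ! 0 = {0} \<and> A ! length a = UNIV
      \<and> (\<forall>i < length a. A ! i \<subseteq> A ! Suc i
           \<and> vector_space.dim s (A ! Suc i) = vector_space.dim s (A ! i) + a ! i)}"

abbreviation flag_image :: "('v \<Rightarrow> 'v) \<Rightarrow> 'v set list \<Rightarrow> 'v set list" where
  "flag_image g A \<equiv> map ((`) g) A"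

type_synonym partition_triple = "nat list \<times> nat list \<times> nat list"

definition Lambda_J :: "nat \<Rightarrow> nat \<Rightarrow> nat \<Rightarrow> partition_triple set" where
  "Lambda_J r p q = {(a, b, c).
      length a = r \<and> length b = p \<and> length c = q
      \<and> sum_list a = sum_list b \<and> sum_list b = sum_list c
      \<and> sum_list a = sum_list (butlast b) + sum_list (butlast c)}"

definition internal_direct_sum :: "'v::ab_group_add set \<Rightarrow> 'v set \<Rightarrow> 'v set \<Rightarrow> bool" where
  "internal_direct_sum U W V \<longleftrightarrow> U \<inter> W = {0} \<and> {u + w | u w. u \<in> U \<and> w \<in> W} = V"

definition Jl ::
    "('k::field \<Rightarrow> 'v::ab_group_add \<Rightarrow> 'v) \<Rightarrow> partition_triple
      \<Rightarrow> ('v set list \<times> 'v set list \<times> 'v set list) set" where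
  "Jl s = (\<lambda>(a, b, c). {(A, B, C).
      A \<in> Fl s a \<and> B \<in> Fl s b \<and> C \<in> Fl s c
      \<and> internal_direct_sum (B ! (length b - 1)) (C ! (length c - 1)) UNIV})"

definition Jl_action ::
    "('k::field \<Rightarrow> 'v::ab_group_add \<Rightarrow> 'v) \<Rightarrow> partition_triple \<Rightarrow> ('v \<Rightarrow> 'v)
      \<Rightarrow> 'v set list \<times> 'v set list \<times> 'v set list
      \<Rightarrow> 'v set list \<times> 'v set list \<times> 'v set list" where
  "Jl_action s d g =
     (\<lambda>(A, B, C) \<in> Jl s d. (flag_image g A, flag_image g B, flag_image g C))"

definition finite_type_J ::
    "('k::field \<Rightarrow> 'v::ab_group_add \<Rightarrow> 'v) \<Rightarrow> partition_triple \<Rightarrow> bool" where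
  "finite_type_J s d \<longleftrightarrow> finite (orbits (GL s) (Jl s d) (Jl_action s d))"

text \<open>
  \<open>V\<^sub>1 = V\<^sub>2 \<oplus> V\<^sub>3\<close> is the product type with the componentwise scalar multiplication
  \<open>module_prod.scale s2 s3\<close>; a pair \<open>(g, h)\<close> acts on it by \<open>map_prod g h\<close>.
\<close>

definition Dl ::
    "('k::field \<Rightarrow> 'v::ab_group_add \<Rightarrow> 'v) \<Rightarrow> ('k \<Rightarrow> 'w::ab_group_add \<Rightarrow> 'w)
      \<Rightarrow> partition_triple \<Rightarrow> (('v \<times> 'w) set list \<times> 'v set list \<times> 'w set list) set" where
  "Dl s2 s3 = (\<lambda>(a, b, c).
     Fl (module_prod.scale s2 s3) a \<times> Fl s2 (butlast b) \<times> Fl s3 (butlast c))"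

definition Dl_action ::
    "('k::field \<Rightarrow> 'v::ab_group_add \<Rightarrow> 'v) \<Rightarrow> ('k \<Rightarrow> 'w::ab_group_add \<Rightarrow> 'w)
      \<Rightarrow> partition_triple \<Rightarrow> ('v \<Rightarrow> 'v) \<times> ('w \<Rightarrow> 'w)
      \<Rightarrow> ('v \<times> 'w) set list \<times> 'v set list \<times> 'w set list
      \<Rightarrow> ('v \<times> 'w) set list \<times> 'v set list \<times> 'w set list" where
  "Dl_action s2 s3 d = (\<lambda>(g, h).
     \<lambda>(A, B, C) \<in> Dl s2 s3 d. (flag_image (map_prod g h) A, flag_image g B, flag_image h C))"

definition finite_type_D ::
    "('k::field \<Rightarrow> 'v::ab_group_add \<Rightarrow> 'v) \<Rightarrow> ('k \<Rightarrow> 'w::ab_group_add \<Rightarrow> 'w)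
      \<Rightarrow> partition_triple \<Rightarrow> bool" where
  "finite_type_D s2 s3 d \<longleftrightarrow>
     finite (orbits (GL s2 \<times>\<times> GL s3) (Dl s2 s3 d) (Dl_action s2 s3 d))"

end

theory Submission
  imports Defs
begin

text \<open>
  A point \<open>(A, B, C)\<close> of the joint flag variety determines a decomposition of \<open>V\<close> into the two
  penultimate steps \<open>B\<^sub>p\<^sub>-\<^sub>1 \<oplus> C\<^sub>q\<^sub>-\<^sub>1\<close>. All decompositions with the given dimensions
  are conjugate under \<open>GL(V)\<close>, and the stabilizer of one of them is \<open>GL(V\<^sub>2) \<times> GL(V\<^sub>3)\<close>. Once the
  decomposition is fixed, what remains is the flag \<open>A\<close> and, from \<open>B\<close> and \<open>C\<close>, a flag in each
  summand, so the fibre over a decomposition is the double flag variety. In other words, the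
  joint flag variety is the bundle over \<open>GL(V) / (GL(V\<^sub>2) \<times> GL(V\<^sub>3))\<close> associated with the double flag variety, and the orbits
  of a group on such a bundle are in bijection with the orbits of the subgroup on the fibre.

  In the formal text a decomposition is parametrised by a linear bijection
  \<open>\<phi> : V\<^sub>2 \<times> V\<^sub>3 \<rightarrow> V\<close>, and \<open>glue \<phi>\<close> includes the double flag variety as the fibre over the
  decomposition given by \<open>\<phi>\<close>. Three facts carry the proof. Every joint flag is glued along some
  \<open>\<psi>\<close> (\<open>Jl_glue_cases\<close>), and \<open>\<psi> = k \<circ> \<phi>\<close> with \<open>k\<close> in \<open>GL(V)\<close> (\<open>iso_transitive\<close>), so the
  image of \<open>glue \<phi>\<close> meets every orbit. If \<open>k\<close> maps one point of that image to another, then it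
  preserves both summands and is therefore a pair \<open>(g, h)\<close> acting componentwise
  (\<open>iso_same_slices_imp_map_prod\<close>), so two such points that are conjugate under \<open>GL(V)\<close>
  are already conjugate under \<open>GL(V\<^sub>2) \<times> GL(V\<^sub>3)\<close> (\<open>orbit_Dl_eq\<close>). The comparison of the two
  sets of orbits is then formal (\<open>finite_orbits_iff_of_reflecting\<close>).
\<close>

section \<open>Orbits of group actions\<close>

text \<open>
  An action is encoded as a homomorphism into the group of extensional bijections of \<open>E\<close>;
  bijectivity comes from the inverses in the group.
\<close>

lemma group_actionI:
  assumes "group G"
    and closed: "\<And>g x. g \<in> carrier G \<Longrightarrow> x \<in> E \<Longrightarrow> f g x \<in> E"
    and one: "\<And>x. x \<in> E \<Longrightarrow> f \<one>\<^bsub>G\<^esub> x = x"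
    and mult: "\<And>g h x. g \<in> carrier G \<Longrightarrow> h \<in> carrier G \<Longrightarrow> x \<in> E \<Longrightarrow> f (g \<otimes>\<^bsub>G\<^esub> h) x = f g (f h x)"
  shows "group_action G E (\<lambda>g. restrict (f g) E)"
proof -
  interpret group G by fact
  have inv: "f (inv\<^bsub>G\<^esub> g) (f g x) = x" "f g (f (inv\<^bsub>G\<^esub> g) x) = x" if "g \<in> carrier G" "x \<in> E" for g x
    using that mult[of "inv\<^bsub>G\<^esub> g" g x] mult[of g "inv\<^bsub>G\<^esub> g" x] one[of x]
    by (simp_all add: l_inv r_inv)
  have Bij: "restrict (f g) E \<in> Bij E" if g: "g \<in> carrier G" for g
  proof -
    have "bij_betw (f g) E E"
      by (rule bij_betwI[where g = "f (inv\<^bsub>G\<^esub> g)"]) (use g inv closed in auto)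
    then show ?thesis by (simp add: Bij_def)
  qed
  have "(\<lambda>g. restrict (f g) E) \<in> hom G (BijGroup E)"
  proof (rule homI)
    fix g h assume gh: "g \<in> carrier G" "h \<in> carrier G"
    then show "restrict (f (g \<otimes>\<^bsub>G\<^esub> h)) E
        = restrict (f g) E \<otimes>\<^bsub>BijGroup E\<^esub> restrict (f h) E"
      using Bij by (auto simp: BijGroup_def compose_def mult closed intro!: restrict_ext)
  qed (simp add: BijGroup_def Bij)
  then show ?thesis
    using \<open>group G\<close> by (simp add: group_action_def group_hom_def group_hom_axioms_def group_BijGroup)
qed

lemma (in group_action) orbit_eqI:
  assumes "x \<in> E" "y \<in> orbit G \<phi> x"
  shows "orbit G \<phi> y = orbit G \<phi> x"
proof -
  have sub: "orbit G \<phi> z \<subseteq> E" if "z \<in> E" for z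
    using that by (auto simp: orbit_def element_image)
  then have "y \<in> E" using assms by blast
  then show ?thesis
    using assms sub orbit_sym orbit_trans by blast
qed

text \<open>
  Two actions are compared along a map \<open>f\<close> of the underlying sets that reflects and preserves
  the orbit relation and that meets every orbit of the target: then taking preimages under \<open>f\<close>
  is a bijection between the orbits. It is injective because each orbit of the target, being
  the class of some \<open>f x\<close> under an equivalence relation, is determined by any point it contains.
\<close>

lemma (in group_action) finite_orbits_iff_of_reflecting:
  assumes f: "\<And>x. x \<in> X \<Longrightarrow> f x \<in> E"
    and reflects: "\<And>x. x \<in> X \<Longrightarrow> orbit H \<psi> x = {x' \<in> X. f x' \<in> orbit G \<phi> (f x)}"
    and meets: "\<And>y. y \<in> E \<Longrightarrow> \<exists>x\<in>X. y \<in> orbit G \<phi> (f x)"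
  shows "finite (orbits H X \<psi>) \<longleftrightarrow> finite (orbits G E \<phi>)"
proof -
  have J: "orbits G E \<phi> = (\<lambda>x. orbit G \<phi> (f x)) ` X"
  proof
    show "orbits G E \<phi> \<subseteq> (\<lambda>x. orbit G \<phi> (f x)) ` X"
    proof
      fix R assume "R \<in> orbits G E \<phi>"
      then obtain y where y: "y \<in> E" "R = orbit G \<phi> y"
        unfolding orbits_def by blast
      then obtain x where x: "x \<in> X" "y \<in> orbit G \<phi> (f x)"
        using meets by blast
      have "R = orbit G \<phi> (f x)"
        unfolding y(2) using orbit_eqI f x by blast
      then show "R \<in> (\<lambda>x. orbit G \<phi> (f x)) ` X"
        using x(1) by blast
    qed
    show "(\<lambda>x. orbit G \<phi> (f x)) ` X \<subseteq> orbits G E \<phi>"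
      using f by (auto simp: orbits_def)
  qed
  let ?p = "\<lambda>R. {x' \<in> X. f x' \<in> R}"
  have D: "orbits H X \<psi> = ?p ` orbits G E \<phi>"
  proof -
    have "orbits H X \<psi> = orbit H \<psi> ` X"
      by (auto simp: orbits_def)
    also have "\<dots> = (\<lambda>x. ?p (orbit G \<phi> (f x))) ` X"
      using reflects by (rule image_cong[OF refl])
    finally show ?thesis by (simp add: J image_image)
  qed
  have "inj_on ?p (orbits G E \<phi>)"
  proof (rule inj_onI)
    fix R S assume RS: "R \<in> orbits G E \<phi>" "S \<in> orbits G E \<phi>" "?p R = ?p S"
    then obtain x where x: "x \<in> X" "R = orbit G \<phi> (f x)"
      unfolding J by auto
    then have "f x \<in> R" using f orbit_refl by auto
    moreover from this have "f x \<in> S" using x(1) RS(3) by blast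
    ultimately show "R = S" using disjoint_union RS(1,2) by blast
  qed
  then show ?thesis unfolding D by (rule finite_image_iff)
qed

section \<open>The general linear group\<close>

lemma linear_inv:
  assumes "Vector_Spaces.linear s t f" "bij f"
  shows "Vector_Spaces.linear t s (inv_into UNIV f)"
proof -
  interpret Vector_Spaces.linear s t f by fact
  interpret module_pair s t ..
  show ?thesis
    using bij_module_hom_imp_inv_module_hom[OF module_hom_linearI[OF assms(1)] assms(2)]
    by (rule linear_module_homI)
qed

lemma GL_carrier: "g \<in> carrier (GL s) \<longleftrightarrow> Vector_Spaces.linear s s g \<and> bij g"
  by (simp add: GL_def)

lemma group_GL:
  assumes "vector_space s"
  shows "group (GL s)"
proof (rule groupI)
  interpret vector_space s by fact
  show "\<one>\<^bsub>GL s\<^esub> \<in> carrier (GL s)"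
    by (simp add: GL_def linear_id)
  fix g assume g: "g \<in> carrier (GL s)"
  show "\<one>\<^bsub>GL s\<^esub> \<otimes>\<^bsub>GL s\<^esub> g = g"
    by (simp add: GL_def)
  show "\<exists>h\<in>carrier (GL s). h \<otimes>\<^bsub>GL s\<^esub> g = \<one>\<^bsub>GL s\<^esub>"
    using g by (intro bexI[of _ "inv_into UNIV g"])
      (auto simp: GL_def bij_imp_bij_inv bij_is_inj intro: linear_inv)
  fix h assume h: "h \<in> carrier (GL s)"
  show "g \<otimes>\<^bsub>GL s\<^esub> h \<in> carrier (GL s)"
    using g h unfolding GL_def
    by (simp add: Vector_Spaces.linear_compose[of s s h s g] bij_comp)
qed (simp add: GL_def o_assoc)

lemma GL_zero: "g \<in> carrier (GL s) \<Longrightarrow> g 0 = 0"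
  by (auto simp: GL_carrier Vector_Spaces.linear_def intro: module_hom.zero)

text \<open>
  Two injections with the same image differ by the automorphism \<open>u\<inverse> \<circ> v\<close> of their source.
\<close>

lemma GL_of_same_range:
  assumes u: "Vector_Spaces.linear t s u" "inj u"
    and v: "Vector_Spaces.linear t s v" "inj v" and range: "range v = range u"
  obtains g where "g \<in> carrier (GL t)" "\<And>x. v x = u (g x)"
proof -
  interpret u: Vector_Spaces.linear t s u by fact
  interpret v: Vector_Spaces.linear t s v by fact
  define g where "g = (\<lambda>x. inv_into UNIV u (v x))"
  have ug: "u (g x) = v x" for x
    using range f_inv_into_f[of "v x" u UNIV] unfolding g_def by blast
  have eqI: "x = y" if "u x = u y" for x y
    using that u(2) by (simp add: inj_eq)
  have "Vector_Spaces.linear t t g"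
    unfolding Vector_Spaces.linear_iff
    by (auto intro!: eqI simp: ug u.add u.scale v.add v.scale u.vs1.vector_space_axioms)
  moreover have "inj g"
    by (rule injI) (metis ug v(2) injD)
  moreover have "surj g"
  proof (rule UNIV_eq_I[symmetric])
    fix y
    obtain x where "u y = v x" using range by blast
    then have "y = g x" by (intro eqI) (simp add: ug)
    then show "y \<in> range g" by blast
  qed
  ultimately show ?thesis using that[of g] ug by (simp add: GL_carrier bij_def)
qed

section \<open>Flags and linear maps\<close>

lemma dim_image_inj:
  assumes "finite_dimensional_vector_space s Bs" "Vector_Spaces.linear s t f" "inj f"
  shows "vector_space.dim t (f ` S) = vector_space.dim s S"
proof -
  interpret Vector_Spaces.linear s t f by fact
  interpret finite_dimensional_vector_space s Bs by fact
  interpret finite_dimensional_vector_space_pair_1 s Bs t ..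
  show ?thesis
    using assms by (intro dim_image_eq) (auto intro: inj_on_subset)
qed

lemma Fl_mono:
  assumes "A \<in> Fl s a" "i \<le> j" "j \<le> length a"
  shows "A ! i \<subseteq> A ! j"
  using assms(2,3)
proof (induction j rule: dec_induct)
  case (step n)
  then have "A ! n \<subseteq> A ! Suc n" using assms(1) by (simp add: Fl_def)
  then show ?case using step by simp
qed simp

lemma Fl_dim:
  assumes "vector_space s" "A \<in> Fl s a" "i \<le> length a"
  shows "vector_space.dim s (A ! i) = sum_list (take i a)"
  using assms(3)
proof (induction i)
  case 0
  interpret vector_space s by fact
  have "dim {0} = dim {}" by (metis dim_span span_empty)
  also have "\<dots> = 0" using dim_unique[of "{}" "{}" 0] by (simp add: independent_empty)
  finally show ?case using assms(2) by (simp add: Fl_def)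
next
  case (Suc i)
  then show ?case using assms(2) by (simp add: Fl_def take_Suc_conv_app_nth)
qed

lemma Fl_map_image:
  assumes fd: "finite_dimensional_vector_space s Bs"
    and f: "Vector_Spaces.linear s t f" "bij f" and A: "A \<in> Fl s a"
  shows "map ((`) f) A \<in> Fl t a"
proof -
  interpret Vector_Spaces.linear s t f by fact
  have "f ` UNIV = UNIV" using f(2) by (simp add: bij_def)
  moreover have "vector_space.dim t (f ` S) = vector_space.dim s S" for S
    by (rule dim_image_inj[OF fd f(1) bij_is_inj[OF f(2)]])
  ultimately show ?thesis
    using A by (simp add: Fl_def subspace_image image_mono)
qed

text \<open>
  A flag in a subspace, given by an injection \<open>u\<close> onto that subspace, becomes a flag in the whole
  space by adding the whole space as its top step.
\<close>

definition embed_flag :: "('w \<Rightarrow> 'v) \<Rightarrow> 'w set list \<Rightarrow> 'v set list" where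
  "embed_flag u A = map ((`) u) A @ [UNIV]"

lemma embed_flag_penultimate:
  assumes "A \<in> Fl s (butlast b)" "b \<noteq> []"
  shows "embed_flag u A ! (length b - 1) = range u"
  using assms by (auto simp: embed_flag_def Fl_def nth_append)

lemma embed_flag_in_Fl:
  assumes fd: "finite_dimensional_vector_space s Bs"
    and u: "Vector_Spaces.linear s t u" "inj u"
    and b: "b \<noteq> []" and dim: "vector_space.dim t UNIV = sum_list b"
    and A: "A \<in> Fl s (butlast b)"
  shows "embed_flag u A \<in> Fl t b"
proof -
  interpret Vector_Spaces.linear s t u by fact
  obtain b' n where b_eq: "b = b' @ [n]" using b by (cases b rule: rev_cases) auto
  have A': "A \<in> Fl s b'" using A b_eq by simp
  have len: "length A = Suc (length b')" using A' by (simp add: Fl_def)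
  have top: "A ! length b' = UNIV" using A' by (simp add: Fl_def)
  have di: "vector_space.dim t (u ` S) = vector_space.dim s S" for S
    by (rule dim_image_inj[OF fd u])
  have "vector_space.dim s UNIV = sum_list b'"
    using Fl_dim[OF vs1.vector_space_axioms A', of "length b'"] top by simp
  then have dim': "vector_space.dim t UNIV = vector_space.dim t (range u) + n"
    using dim di b_eq by simp
  have nth: "embed_flag u A ! i = (if i \<le> length b' then u ` (A ! i) else UNIV)" if "i \<le> length b" for i
    using that len b_eq by (auto simp: embed_flag_def nth_append)
  show ?thesis
    unfolding Fl_def
  proof (intro CollectI conjI allI impI)
    fix i assume i: "i < length b"
    show "embed_flag u A ! i \<subseteq> embed_flag u A ! Suc i"
    proof (cases "i < length b'")
      case True
      then have "u ` (A ! i) \<subseteq> u ` (A ! Suc i)" using A' by (intro image_mono) (simp add: Fl_def)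
      then show ?thesis using i True by (simp add: nth b_eq)
    qed (use i b_eq in \<open>simp add: nth\<close>)
    show "vector_space.dim t (embed_flag u A ! Suc i) = vector_space.dim t (embed_flag u A ! i) + b ! i"
    proof (cases "i < length b'")
      case True
      then show ?thesis using i A' by (simp add: nth b_eq Fl_def di nth_append)
    next
      case False
      then have "i = length b'" using i b_eq by simp
      then show ?thesis using i dim' top by (simp add: nth b_eq nth_append)
    qed
  next
    fix i assume "i \<le> length b"
    then show "module.subspace t (embed_flag u A ! i)"
      using A' by (simp add: nth Fl_def subspace_image)
  qed (use A' len b_eq nth in \<open>auto simp: Fl_def embed_flag_def nth_append\<close>)
qed

text \<open>
  Conversely, each step of a flag below the penultimate one lies in the image of \<open>u\<close>, so it is
  recovered from its preimage, and \<open>u\<close> preserves its dimension.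
\<close>

lemma embed_flag_cases:
  assumes fd: "finite_dimensional_vector_space s Bs"
    and u: "Vector_Spaces.linear s t u" "inj u"
    and b: "b \<noteq> []" and B: "B \<in> Fl t b" and pen: "B ! (length b - 1) = range u"
  obtains A where "A \<in> Fl s (butlast b)" "B = embed_flag u A"
proof -
  interpret Vector_Spaces.linear s t u by fact
  obtain b' n where b_eq: "b = b' @ [n]" using b by (cases b rule: rev_cases) auto
  have len: "length B = length b' + 2" using B b_eq by (simp add: Fl_def)
  have im: "u ` (u -` (B ! i)) = B ! i" if "i \<le> length b'" for i
    using Fl_mono[OF B that] that pen b_eq by auto
  have di: "vector_space.dim s (u -` (B ! i)) = vector_space.dim t (B ! i)" if "i \<le> length b'" for i
    using dim_image_inj[OF fd u, of "u -` (B ! i)"] im[OF that] by simp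
  define A where "A = map ((-`) u) (butlast B)"
  have nth: "A ! i = u -` (B ! i)" if "i \<le> length b'" for i
    using that len by (simp add: A_def nth_butlast)
  have "A \<in> Fl s b'"
    unfolding Fl_def
  proof (intro CollectI conjI allI impI)
    show "A ! 0 = {0}"
    proof -
      have "A ! 0 = u -` {0}" using B by (simp add: nth Fl_def)
      also have "\<dots> = {0}" using u(2) zero by (auto simp: inj_def)
      finally show ?thesis .
    qed
    show "A ! length b' = UNIV" using pen b_eq by (auto simp: nth)
    fix i assume i: "i < length b'"
    show "A ! i \<subseteq> A ! Suc i"
      using i B by (simp add: nth Fl_def b_eq vimage_mono)
    show "vector_space.dim s (A ! Suc i) = vector_space.dim s (A ! i) + b' ! i"
      using i B by (simp add: nth di Fl_def b_eq nth_append)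
  next
    fix i assume "i \<le> length b'"
    then show "module.subspace s (A ! i)"
      using B by (simp add: nth Fl_def b_eq subspace_vimage)
  qed (simp add: A_def len)
  moreover have "B = embed_flag u A"
  proof (rule nth_equalityI)
    show "length B = length (embed_flag u A)" by (simp add: embed_flag_def A_def len)
    fix i assume i: "i < length B"
    show "B ! i = embed_flag u A ! i"
    proof (cases "i \<le> length b'")
      case True
      then have "embed_flag u A ! i = u ` (A ! i)"
        by (simp add: embed_flag_def nth_append A_def len)
      then show ?thesis using im[OF True] nth[OF True] by metis
    next
      case False
      then have "i = Suc (length b')" using i len by simp
      then show ?thesis using B b_eq by (simp add: embed_flag_def nth_append A_def len Fl_def)
    qed
  qed
  ultimately show ?thesis using that b_eq by simp
qed

section \<open>Gluing double flags to joint flags\<close>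

text \<open>
  For a linear bijection \<open>\<phi> : V\<^sub>2 \<times> V\<^sub>3 \<rightarrow> V\<close> this transports a double flag to \<open>V\<close> so that the images
  of \<open>V\<^sub>2\<close> and \<open>V\<^sub>3\<close> become the penultimate steps of the second and third flag.
\<close>

definition glue ::
    "('v::zero \<times> 'w::zero \<Rightarrow> 'u) \<Rightarrow> ('v \<times> 'w) set list \<times> 'v set list \<times> 'w set list
      \<Rightarrow> 'u set list \<times> 'u set list \<times> 'u set list" where
  "glue \<phi> = (\<lambda>(A, B, C). (map ((`) \<phi>) A,
     embed_flag (\<lambda>x. \<phi> (x, 0)) B, embed_flag (\<lambda>y. \<phi> (0, y)) C))"

abbreviation triple_image ::
    "('u \<Rightarrow> 'u) \<Rightarrow> 'u set list \<times> 'u set list \<times> 'u set list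
      \<Rightarrow> 'u set list \<times> 'u set list \<times> 'u set list" where
  "triple_image k \<equiv> (\<lambda>(A, B, C). (flag_image k A, flag_image k B, flag_image k C))"

lemma embed_flag_comp:
  "surj k \<Longrightarrow> embed_flag (\<lambda>x. k (u x)) A = map ((`) k) (embed_flag u A)"
  by (simp add: embed_flag_def image_image)

lemma inj_map_image: "inj u \<Longrightarrow> inj (map ((`) u))"
  by (auto intro!: inj_mapI injI simp: inj_image_eq_iff)

lemma inj_embed_flag: "inj u \<Longrightarrow> inj (embed_flag u)"
  using inj_map_image[of u] by (auto simp: embed_flag_def inj_def)

text \<open>
  Composing \<open>\<phi>\<close> on the left is the action on joint flags, composing it on the right with a
  componentwise map is the action on double flags. Comparing \<open>k \<circ> \<phi>\<close> with \<open>\<phi> \<circ> map_prod g h\<close>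
  therefore compares the two actions.
\<close>

lemma glue_comp: "surj k \<Longrightarrow> glue (k \<circ> \<phi>) x = triple_image k (glue \<phi> x)"
  by (cases x) (simp add: glue_def embed_flag_comp[symmetric] image_comp)

lemma glue_map_prod:
  assumes "g 0 = 0" "h 0 = 0"
  shows "glue (\<phi> \<circ> map_prod g h) (A, B, C)
    = glue \<phi> (map ((`) (map_prod g h)) A, flag_image g B, flag_image h C)"
  using assms by (simp add: glue_def embed_flag_def image_comp image_image)

lemma inj_glue:
  assumes "inj \<phi>"
  shows "inj (glue \<phi>)"
proof -
  have "inj (\<lambda>x. \<phi> (x, 0))" "inj (\<lambda>y. \<phi> (0, y))"
    using assms by (auto simp: inj_def)
  then have "inj (embed_flag (\<lambda>x. \<phi> (x, 0)))" "inj (embed_flag (\<lambda>y. \<phi> (0, y)))"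
    by (simp_all add: inj_embed_flag)
  with inj_map_image[OF assms] show ?thesis
    by (auto simp: glue_def inj_def)
qed

text \<open>
  The numerical conditions on the triple of partitions are kept in the form in which they are
  needed: \<open>|b'| = c\<^sub>q\<close> and \<open>|c'| = b\<^sub>p\<close> are the dimensions of the two summands.
\<close>

locale joint_double =
  fixes s :: "'k::field \<Rightarrow> 'v::ab_group_add \<Rightarrow> 'v"
    and s2 :: "'k \<Rightarrow> 'v2::ab_group_add \<Rightarrow> 'v2"
    and s3 :: "'k \<Rightarrow> 'v3::ab_group_add \<Rightarrow> 'v3"
    and Bs B2 B3 and b c :: "nat list"
  assumes V: "finite_dimensional_vector_space s Bs"
    and V2: "finite_dimensional_vector_space s2 B2"
    and V3: "finite_dimensional_vector_space s3 B3"
    and nonempty: "b \<noteq> []" "c \<noteq> []"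
    and dim_V: "card Bs = sum_list b" "card Bs = sum_list c"
    and dim_V2: "card B2 = sum_list (butlast b)"
    and dim_V3: "card B3 = sum_list (butlast c)"
    and dim_sum: "card Bs = sum_list (butlast b) + sum_list (butlast c)"
begin

sublocale V: finite_dimensional_vector_space s Bs by (rule V)
sublocale V2: finite_dimensional_vector_space s2 B2 by (rule V2)
sublocale V3: finite_dimensional_vector_space s3 B3 by (rule V3)
sublocale V1: finite_dimensional_vector_space_prod s2 s3 B2 B3 ..

definition V1_iso :: "('v2 \<times> 'v3 \<Rightarrow> 'v) \<Rightarrow> bool" where
  "V1_iso \<phi> \<longleftrightarrow> Vector_Spaces.linear V1.scale s \<phi> \<and> bij \<phi>"

lemma map_prod_GL:
  assumes "g \<in> carrier (GL s2)" "h \<in> carrier (GL s3)"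
  shows "map_prod g h \<in> carrier (GL V1.scale)"
proof -
  interpret g: Vector_Spaces.linear s2 s2 g using assms(1) by (simp add: GL_carrier)
  interpret h: Vector_Spaces.linear s3 s3 h using assms(2) by (simp add: GL_carrier)
  have "Vector_Spaces.linear V1.scale V1.scale (map_prod g h)"
    by (auto simp: Vector_Spaces.linear_iff V1.p.vector_space_axioms V1.scale_prod
        g.add h.add g.scale h.scale)
  moreover have "bij (map_prod g h)"
    using assms by (simp add: GL_carrier bij_def prod.inj_map map_prod_surj)
  ultimately show ?thesis by (simp add: GL_carrier)
qed

lemma iso_exists: "\<exists>\<phi>. V1_iso \<phi>"
proof -
  interpret P: finite_dimensional_vector_space_pair V1.scale V1.Basis_pair s Bs ..
  have "V1.p.dimension = V.dimension"
    using V1.dimension_pair by (simp add: V.dimension_def V2.dimension_def V3.dimension_def dim_V2 dim_V3 dim_sum)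
  then show ?thesis
    using P.basis_change_exists by (auto simp: V1_iso_def)
qed

lemma iso_comp:
  assumes "V1_iso \<phi>" "k \<in> carrier (GL s)"
  shows "V1_iso (k \<circ> \<phi>)"
  using assms by (auto simp: V1_iso_def GL_carrier intro: Vector_Spaces.linear_compose bij_comp)

lemma iso_transitive:
  assumes \<phi>: "V1_iso \<phi>" and \<psi>: "V1_iso \<psi>"
  obtains k where "k \<in> carrier (GL s)" "\<psi> = k \<circ> \<phi>"
proof
  have "Vector_Spaces.linear s V1.scale (inv_into UNIV \<phi>)" "bij (inv_into UNIV \<phi>)"
    using \<phi> by (auto simp: V1_iso_def intro: linear_inv bij_imp_bij_inv)
  then show "\<psi> \<circ> inv_into UNIV \<phi> \<in> carrier (GL s)"
    using \<psi> by (auto simp: V1_iso_def GL_carrier intro: Vector_Spaces.linear_compose bij_comp)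
  show "\<psi> = (\<psi> \<circ> inv_into UNIV \<phi>) \<circ> \<phi>"
    using \<phi> by (simp add: V1_iso_def bij_def comp_assoc)
qed

lemma iso_comp_map_prod:
  assumes "V1_iso \<phi>" and g: "g \<in> carrier (GL s2)" and h: "h \<in> carrier (GL s3)"
  shows "V1_iso (\<phi> \<circ> map_prod g h)"
  using assms(1) map_prod_GL[OF g h]
  by (auto simp: V1_iso_def GL_carrier intro: Vector_Spaces.linear_compose bij_comp)

lemma linear_fst_slice:
  assumes "V1_iso \<phi>"
  shows "Vector_Spaces.linear s2 s (\<lambda>x. \<phi> (x, 0))" "inj (\<lambda>x. \<phi> (x, 0))"
proof -
  interpret Vector_Spaces.linear V1.scale s \<phi> using assms by (simp add: V1_iso_def)
  have "\<phi> (x + y, 0) = \<phi> (x, 0) + \<phi> (y, 0)" for x y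
    using add[of "(x, 0)" "(y, 0)"] by simp
  moreover have "\<phi> (s2 r x, 0) = s r (\<phi> (x, 0))" for r x
    using scale[of r "(x, 0)"] by (simp add: V1.scale_prod)
  ultimately show "Vector_Spaces.linear s2 s (\<lambda>x. \<phi> (x, 0))"
    by (simp add: Vector_Spaces.linear_iff V.vector_space_axioms V2.vector_space_axioms)
  show "inj (\<lambda>x. \<phi> (x, 0))"
    using assms by (auto simp: V1_iso_def inj_def bij_def)
qed

lemma linear_snd_slice:
  assumes "V1_iso \<phi>"
  shows "Vector_Spaces.linear s3 s (\<lambda>y. \<phi> (0, y))" "inj (\<lambda>y. \<phi> (0, y))"
proof -
  interpret Vector_Spaces.linear V1.scale s \<phi> using assms by (simp add: V1_iso_def)
  have "\<phi> (0, x + y) = \<phi> (0, x) + \<phi> (0, y)" for x y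
    using add[of "(0, x)" "(0, y)"] by simp
  moreover have "\<phi> (0, s3 r x) = s r (\<phi> (0, x))" for r x
    using scale[of r "(0, x)"] by (simp add: V1.scale_prod)
  ultimately show "Vector_Spaces.linear s3 s (\<lambda>y. \<phi> (0, y))"
    by (simp add: Vector_Spaces.linear_iff V.vector_space_axioms V3.vector_space_axioms)
  show "inj (\<lambda>y. \<phi> (0, y))"
    using assms by (auto simp: V1_iso_def inj_def bij_def)
qed

lemma iso_eq_sum: "V1_iso \<phi> \<Longrightarrow> \<phi> (x, y) = \<phi> (x, 0) + \<phi> (0, y)"
proof -
  assume "V1_iso \<phi>"
  then interpret Vector_Spaces.linear V1.scale s \<phi> by (simp add: V1_iso_def)
  show ?thesis using add[of "(x, 0)" "(0, y)"] by simp
qed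

lemma direct_sum_slices:
  assumes "V1_iso \<phi>"
  shows "internal_direct_sum (range (\<lambda>x. \<phi> (x, 0))) (range (\<lambda>y. \<phi> (0, y))) UNIV"
  unfolding internal_direct_sum_def
proof
  interpret Vector_Spaces.linear V1.scale s \<phi> using assms by (simp add: V1_iso_def)
  have "\<phi> (0, 0) = 0" using zero by (simp add: zero_prod_def)
  then show "range (\<lambda>x. \<phi> (x, 0)) \<inter> range (\<lambda>y. \<phi> (0, y)) = {0}"
    using assms by (force simp: V1_iso_def bij_def inj_def)
  show "{u + w |u w. u \<in> range (\<lambda>x. \<phi> (x, 0)) \<and> w \<in> range (\<lambda>y. \<phi> (0, y))} = UNIV"
  proof (intro UNIV_eq_I[symmetric] CollectI)
    fix v
    obtain x y where "v = \<phi> (x, y)"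
      using assms unfolding V1_iso_def bij_def by (metis surj_def surj_pair)
    then show "\<exists>u w. v = u + w \<and> u \<in> range (\<lambda>x. \<phi> (x, 0)) \<and> w \<in> range (\<lambda>y. \<phi> (0, y))"
      using iso_eq_sum[OF assms] by blast
  qed
qed

lemma glue_in_Jl:
  assumes \<phi>: "V1_iso \<phi>" and x: "x \<in> Dl s2 s3 (a, b, c)"
  shows "glue \<phi> x \<in> Jl s (a, b, c)"
proof -
  obtain A B C where x_eq: "x = (A, B, C)" by (cases x)
  have ABC: "A \<in> Fl V1.scale a" "B \<in> Fl s2 (butlast b)" "C \<in> Fl s3 (butlast c)"
    using x by (simp_all add: x_eq Dl_def)
  have "map ((`) \<phi>) A \<in> Fl s a"
    using Fl_map_image[OF V1.p.finite_dimensional_vector_space_axioms _ _ ABC(1)] \<phi>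
    unfolding V1_iso_def by blast
  moreover have "embed_flag (\<lambda>x. \<phi> (x, 0)) B \<in> Fl s b"
    using embed_flag_in_Fl[OF V2 linear_fst_slice[OF \<phi>] nonempty(1) _ ABC(2)] dim_V by simp
  moreover have "embed_flag (\<lambda>y. \<phi> (0, y)) C \<in> Fl s c"
    using embed_flag_in_Fl[OF V3 linear_snd_slice[OF \<phi>] nonempty(2) _ ABC(3)] dim_V by simp
  ultimately show ?thesis
    using direct_sum_slices[OF \<phi>]
      embed_flag_penultimate[OF ABC(2) nonempty(1), of "\<lambda>x. \<phi> (x, 0)"]
      embed_flag_penultimate[OF ABC(3) nonempty(2), of "\<lambda>y. \<phi> (0, y)"]
    by (simp add: x_eq glue_def Jl_def)
qed

text \<open>
  The summands of the decomposition underlying a joint flag have the dimensions of \<open>V\<^sub>2\<close> and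
  \<open>V\<^sub>3\<close>, so they are images of injections \<open>u\<close> and \<open>w\<close>; directness of the sum says exactly that
  \<open>(x, y) \<mapsto> u x + w y\<close> is a bijection, and the joint flag is glued along it.
\<close>

lemma Jl_glue_cases:
  assumes "y \<in> Jl s (a, b, c)"
  obtains \<psi> x where "V1_iso \<psi>" "x \<in> Dl s2 s3 (a, b, c)" "y = glue \<psi> x"
proof -
  obtain A B C where y_eq: "y = (A, B, C)" by (cases y)
  let ?U = "B ! (length b - 1)" and ?W = "C ! (length c - 1)"
  have ABC: "A \<in> Fl s a" "B \<in> Fl s b" "C \<in> Fl s c" and direct: "internal_direct_sum ?U ?W UNIV"
    using assms by (simp_all add: y_eq Jl_def)
  have sub: "V.subspace ?U" "V.subspace ?W"
    using ABC by (simp_all add: Fl_def)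
  have dims: "V2.dim UNIV = V.dim ?U" "V3.dim UNIV = V.dim ?W"
    using Fl_dim[OF V.vector_space_axioms ABC(2), of "length b - 1"]
      Fl_dim[OF V.vector_space_axioms ABC(3), of "length c - 1"] dim_V2 dim_V3
    by (simp_all add: butlast_conv_take)
  interpret P2: finite_dimensional_vector_space_pair s2 B2 s Bs ..
  interpret P3: finite_dimensional_vector_space_pair s3 B3 s Bs ..
  obtain u where u: "Vector_Spaces.linear s2 s u" "range u = ?U" "inj u"
    using P2.subspace_isomorphism[OF V2.subspace_UNIV sub(1) dims(1)] by auto
  obtain w where w: "Vector_Spaces.linear s3 s w" "range w = ?W" "inj w"
    using P3.subspace_isomorphism[OF V3.subspace_UNIV sub(2) dims(2)] by auto
  interpret u: Vector_Spaces.linear s2 s u by (rule u(1))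
  interpret w: Vector_Spaces.linear s3 s w by (rule w(1))
  define \<psi> where "\<psi> = (\<lambda>(x, y). u x + w y)"
  have lin: "Vector_Spaces.linear V1.scale s \<psi>"
    by (auto simp: Vector_Spaces.linear_iff V.vector_space_axioms V1.p.vector_space_axioms \<psi>_def V1.scale_prod
        u.add w.add u.scale w.scale V.scale_right_distrib)
  interpret \<psi>: Vector_Spaces.linear V1.scale s \<psi> by (rule lin)
  have "inj \<psi>"
    unfolding \<psi>.inj_iff_eq_0
  proof (intro allI impI)
    fix z assume z: "\<psi> z = 0"
    obtain x y where z_eq: "z = (x, y)" by (cases z)
    have "u x = w (- y)"
      using z by (simp add: z_eq \<psi>_def w.neg eq_neg_iff_add_eq_0)
    then have "u x \<in> ?U \<inter> ?W" using u(2) w(2) by (metis IntI rangeI)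
    then have "u x = 0" using direct unfolding internal_direct_sum_def by blast
    then have "u x = 0" "w y = 0" using z by (simp_all add: z_eq \<psi>_def)
    then have "x = 0" "y = 0" using u(3) w(3) u.inj_iff_eq_0 w.inj_iff_eq_0 by blast+
    then show "z = 0" by (simp add: z_eq zero_prod_def)
  qed
  moreover have "surj \<psi>"
  proof (rule UNIV_eq_I[symmetric])
    fix v
    have "v \<in> {p + q | p q. p \<in> ?U \<and> q \<in> ?W}"
      using direct by (simp add: internal_direct_sum_def)
    then obtain p q where pq: "v = p + q" "p \<in> ?U" "q \<in> ?W" by blast
    then obtain x y where "p = u x" "q = w y" using u(2) w(2) by blast
    then show "v \<in> range \<psi>" using pq by (auto simp: \<psi>_def intro!: image_eqI[of _ _ "(x, y)"])
  qed
  ultimately have V1_iso: "V1_iso \<psi>" using lin by (simp add: V1_iso_def bij_def)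
  have slices: "(\<lambda>x. \<psi> (x, 0)) = u" "(\<lambda>y. \<psi> (0, y)) = w"
    by (simp_all add: \<psi>_def)
  obtain B' where B': "B' \<in> Fl s2 (butlast b)" "B = embed_flag u B'"
    using embed_flag_cases[OF V2 u(1,3) nonempty(1) ABC(2) u(2)[symmetric]] .
  obtain C' where C': "C' \<in> Fl s3 (butlast c)" "C = embed_flag w C'"
    using embed_flag_cases[OF V3 w(1,3) nonempty(2) ABC(3) w(2)[symmetric]] .
  have inv: "Vector_Spaces.linear s V1.scale (inv_into UNIV \<psi>)" "bij (inv_into UNIV \<psi>)"
    using V1_iso by (auto simp: V1_iso_def intro: linear_inv bij_imp_bij_inv)
  define A' where "A' = map ((`) (inv_into UNIV \<psi>)) A"
  have "A' \<in> Fl V1.scale a"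
    unfolding A'_def by (rule Fl_map_image[OF V inv ABC(1)])
  moreover have "map ((`) \<psi>) A' = A"
    using \<open>surj \<psi>\<close> by (simp add: A'_def image_comp surj_iff map_idI)
  ultimately have "(A', B', C') \<in> Dl s2 s3 (a, b, c)" "y = glue \<psi> (A', B', C')"
    using B' C' by (simp_all add: Dl_def glue_def y_eq slices)
  then show ?thesis using that V1_iso by blast
qed

text \<open>
  Two parametrisations give the same decomposition only if they differ by a componentwise
  automorphism: this is the computation of the stabilizer of a decomposition.
\<close>

lemma iso_same_slices_imp_map_prod:
  assumes \<phi>: "V1_iso \<phi>" and \<psi>: "V1_iso \<psi>"
    and U: "range (\<lambda>x. \<psi> (x, 0)) = range (\<lambda>x. \<phi> (x, 0))"
    and W: "range (\<lambda>y. \<psi> (0, y)) = range (\<lambda>y. \<phi> (0, y))"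
  obtains g h where "g \<in> carrier (GL s2)" "h \<in> carrier (GL s3)" "\<psi> = \<phi> \<circ> map_prod g h"
proof -
  obtain g where g: "g \<in> carrier (GL s2)" "\<And>x. \<psi> (x, 0) = \<phi> (g x, 0)"
    using GL_of_same_range[OF linear_fst_slice[OF \<phi>] linear_fst_slice[OF \<psi>] U] by blast
  obtain h where h: "h \<in> carrier (GL s3)" "\<And>y. \<psi> (0, y) = \<phi> (0, h y)"
    using GL_of_same_range[OF linear_snd_slice[OF \<phi>] linear_snd_slice[OF \<psi>] W] by blast
  have "\<psi> = \<phi> \<circ> map_prod g h"
  proof
    fix z :: "'v2 \<times> 'v3"
    obtain x y where z: "z = (x, y)" by (cases z)
    have "\<psi> (x, y) = \<phi> (g x, 0) + \<phi> (0, h y)"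
      using iso_eq_sum[OF \<psi>, of x y] unfolding g(2) h(2) .
    also have "\<dots> = \<phi> (g x, h y)"
      by (rule iso_eq_sum[OF \<phi>, symmetric])
    finally show "\<psi> z = (\<phi> \<circ> map_prod g h) z"
      by (simp add: z)
  qed
  then show ?thesis using that g(1) h(1) by blast
qed

section \<open>Comparison of the orbits\<close>

text \<open>
  That the joint flag variety is stable under \<open>GL(V)\<close> is seen by gluing along \<open>k \<circ> \<psi>\<close> in place
  of \<open>\<psi>\<close>.
\<close>

lemma group_action_Jl: "group_action (GL s) (Jl s (a, b, c)) (Jl_action s (a, b, c))"
proof -
  have closed: "triple_image k y \<in> Jl s (a, b, c)"
    if k: "k \<in> carrier (GL s)" and y: "y \<in> Jl s (a, b, c)" for k y
  proof -
    obtain \<psi> x where *: "V1_iso \<psi>" "x \<in> Dl s2 s3 (a, b, c)" "y = glue \<psi> x"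
      using Jl_glue_cases[OF y] .
    have "triple_image k y = glue (k \<circ> \<psi>) x"
      unfolding *(3) using k by (intro glue_comp[symmetric]) (simp add: GL_carrier bij_def)
    then show ?thesis
      using glue_in_Jl[OF iso_comp[OF *(1) k] *(2)] by simp
  qed
  have "group_action (GL s) (Jl s (a, b, c)) (\<lambda>k. restrict (triple_image k) (Jl s (a, b, c)))"
    by (rule group_actionI)
      (use closed in \<open>auto simp: group_GL V.vector_space_axioms, auto simp: GL_def image_comp\<close>)
  then show ?thesis by (simp add: Jl_action_def[abs_def])
qed

text \<open>
  Two points of the fibre over \<open>\<phi>\<close> lie in one \<open>GL(V)\<close>-orbit exactly if they lie in one
  \<open>GL(V\<^sub>2) \<times> GL(V\<^sub>3)\<close>-orbit. A pair \<open>(g, h)\<close> extends to \<open>\<phi> \<circ> map_prod g h \<circ> \<phi>\<inverse>\<close>; conversely the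
  penultimate steps record the decomposition, so an element of \<open>GL(V)\<close> that joins two points of
  the fibre fixes the decomposition and comes from such a pair.
\<close>

lemma orbit_Dl_eq:
  assumes \<phi>: "V1_iso \<phi>" and x: "x \<in> Dl s2 s3 (a, b, c)"
  shows "orbit (GL s2 \<times>\<times> GL s3) (Dl_action s2 s3 (a, b, c)) x
    = {x' \<in> Dl s2 s3 (a, b, c). glue \<phi> x' \<in> orbit (GL s) (Jl_action s (a, b, c)) (glue \<phi> x)}"
    (is "?L = ?R")
proof
  obtain A B C where x_eq: "x = (A, B, C)" by (cases x)
  have ABC: "A \<in> Fl V1.scale a" "B \<in> Fl s2 (butlast b)" "C \<in> Fl s3 (butlast c)"
    using x by (simp_all add: x_eq Dl_def)
  let ?act = "\<lambda>g h. (map ((`) (map_prod g h)) A, flag_image g B, flag_image h C)"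
  have act: "Dl_action s2 s3 (a, b, c) (g, h) x = ?act g h" for g h
    using x by (simp add: x_eq Dl_action_def)
  have glue_act: "glue \<phi> (?act g h) = glue (\<phi> \<circ> map_prod g h) x"
    if "g \<in> carrier (GL s2)" "h \<in> carrier (GL s3)" for g h
    using that by (simp add: x_eq glue_map_prod GL_zero)
  have J_act: "Jl_action s (a, b, c) k (glue \<phi> x) = glue (k \<circ> \<phi>) x" if "k \<in> carrier (GL s)" for k
    using that glue_in_Jl[OF \<phi> x] by (simp add: Jl_action_def glue_comp GL_carrier bij_def)
  show "?L \<subseteq> ?R"
  proof
    fix x' assume "x' \<in> ?L"
    then obtain g h where gh: "g \<in> carrier (GL s2)" "h \<in> carrier (GL s3)" and x': "x' = ?act g h"
      by (auto simp: orbit_def act)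
    have "map_prod g h \<in> carrier (GL V1.scale)"
      using gh by (rule map_prod_GL)
    then have "x' \<in> Dl s2 s3 (a, b, c)"
      using gh unfolding x' Dl_def GL_carrier
      by (auto intro: Fl_map_image[OF V2 _ _ ABC(2)] Fl_map_image[OF V3 _ _ ABC(3)]
          Fl_map_image[OF V1.p.finite_dimensional_vector_space_axioms _ _ ABC(1)])
    moreover obtain k where "k \<in> carrier (GL s)" "\<phi> \<circ> map_prod g h = k \<circ> \<phi>"
      using iso_transitive[OF \<phi> iso_comp_map_prod[OF \<phi> gh]] .
    then have "glue \<phi> x' \<in> orbit (GL s) (Jl_action s (a, b, c)) (glue \<phi> x)"
      unfolding x' glue_act[OF gh] orbit_def using J_act by force
    ultimately show "x' \<in> ?R" by simp
  qed
  show "?R \<subseteq> ?L"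
  proof
    fix x' assume "x' \<in> ?R"
    then obtain k where x': "x' \<in> Dl s2 s3 (a, b, c)" and k: "k \<in> carrier (GL s)"
      and eq: "glue (k \<circ> \<phi>) x = glue \<phi> x'"
      by (auto simp: orbit_def J_act)
    obtain A' B' C' where x'_eq: "x' = (A', B', C')" by (cases x')
    have "B' \<in> Fl s2 (butlast b)" "C' \<in> Fl s3 (butlast c)"
      using x' by (simp_all add: x'_eq Dl_def)
    moreover have "embed_flag (\<lambda>x. (k \<circ> \<phi>) (x, 0)) B = embed_flag (\<lambda>x. \<phi> (x, 0)) B'"
      and "embed_flag (\<lambda>y. (k \<circ> \<phi>) (0, y)) C = embed_flag (\<lambda>y. \<phi> (0, y)) C'"
      using eq by (simp_all add: glue_def x_eq x'_eq)
    ultimately have "range (\<lambda>x. (k \<circ> \<phi>) (x, 0)) = range (\<lambda>x. \<phi> (x, 0))"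
      and "range (\<lambda>y. (k \<circ> \<phi>) (0, y)) = range (\<lambda>y. \<phi> (0, y))"
      using ABC(2,3) nonempty embed_flag_penultimate by metis+
    then obtain g h where gh: "g \<in> carrier (GL s2)" "h \<in> carrier (GL s3)"
      and "k \<circ> \<phi> = \<phi> \<circ> map_prod g h"
      using iso_same_slices_imp_map_prod[OF \<phi> iso_comp[OF \<phi> k]] by blast
    then have "glue \<phi> (?act g h) = glue \<phi> x'"
      using eq glue_act by simp
    then have "x' = Dl_action s2 s3 (a, b, c) (g, h) x"
      using inj_glue \<phi> unfolding V1_iso_def bij_def act by (metis injD)
    then show "x' \<in> ?L" using gh by (force simp: orbit_def)
  qed
qed

lemma finite_type_D_iff_J: "finite_type_D s2 s3 (a, b, c) \<longleftrightarrow> finite_type_J s (a, b, c)"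
proof -
  interpret J: group_action "GL s" "Jl s (a, b, c)" "Jl_action s (a, b, c)"
    by (rule group_action_Jl)
  obtain \<phi> where \<phi>: "V1_iso \<phi>" using iso_exists by blast
  show ?thesis
    unfolding finite_type_D_def finite_type_J_def
  proof (rule J.finite_orbits_iff_of_reflecting)
    show "glue \<phi> x \<in> Jl s (a, b, c)" if "x \<in> Dl s2 s3 (a, b, c)" for x
      using \<phi> that by (rule glue_in_Jl)
    show "orbit (GL s2 \<times>\<times> GL s3) (Dl_action s2 s3 (a, b, c)) x
        = {x' \<in> Dl s2 s3 (a, b, c). glue \<phi> x' \<in> orbit (GL s) (Jl_action s (a, b, c)) (glue \<phi> x)}"
      if "x \<in> Dl s2 s3 (a, b, c)" for x
      using \<phi> that by (rule orbit_Dl_eq)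
    fix y assume "y \<in> Jl s (a, b, c)"
    then obtain \<psi> x where \<psi>: "V1_iso \<psi>" and x: "x \<in> Dl s2 s3 (a, b, c)" and y: "y = glue \<psi> x"
      by (rule Jl_glue_cases)
    obtain k where k: "k \<in> carrier (GL s)" "\<psi> = k \<circ> \<phi>"
      using iso_transitive[OF \<phi> \<psi>] .
    have "y = Jl_action s (a, b, c) k (glue \<phi> x)"
      using k glue_in_Jl[OF \<phi> x] by (simp add: y Jl_action_def glue_comp GL_carrier bij_def)
    then show "\<exists>x\<in>Dl s2 s3 (a, b, c). y \<in> orbit (GL s) (Jl_action s (a, b, c)) (glue \<phi> x)"
      using k(1) x by (auto simp: orbit_def)
  qed
qed

end

theorem theorem3p4:
  fixes s :: "'k::{alg_closed_field, field_char_0} \<Rightarrow> 'v::ab_group_add \<Rightarrow> 'v"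
    and s2 :: "'k \<Rightarrow> 'v2::ab_group_add \<Rightarrow> 'v2"
    and s3 :: "'k \<Rightarrow> 'v3::ab_group_add \<Rightarrow> 'v3"
    and r p q :: nat
    and a b c :: "nat list"
  assumes "r > 0" and "p > 0" and "q > 0"
    and "(a, b, c) \<in> Lambda_J r p q"
    and "vector_space_of_dim s (sum_list a)"
    and "vector_space_of_dim s2 (last c)"
    and "vector_space_of_dim s3 (last b)"
  shows "finite_type_D s2 s3 (a, b, c) \<longleftrightarrow> finite_type_J s (a, b, c)"
proof -
  have L: "length b = p" "length c = q" "sum_list a = sum_list b" "sum_list b = sum_list c"
    "sum_list a = sum_list (butlast b) + sum_list (butlast c)"
    using assms(4) by (simp_all add: Lambda_J_def)
  have nonempty: "b \<noteq> []" "c \<noteq> []" using L(1,2) assms(2,3) by auto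
  have "sum_list b = sum_list (butlast b) + last b" "sum_list c = sum_list (butlast c) + last c"
    using nonempty by (metis append_butlast_last_id sum_list_append sum_list.Cons sum_list.Nil add_0_right)+
  then have last: "last c = sum_list (butlast b)" "last b = sum_list (butlast c)"
    using L by simp_all
  obtain Bs B2 B3 where "finite_dimensional_vector_space s Bs" "card Bs = sum_list a"
    "finite_dimensional_vector_space s2 B2" "card B2 = last c"
    "finite_dimensional_vector_space s3 B3" "card B3 = last b"
    using assms(5-7) by (auto simp: vector_space_of_dim_def)
  then have "joint_double s s2 s3 Bs B2 B3 b c"
    using nonempty L last by (simp add: joint_double_def)
  then show ?thesis
    by (rule joint_double.finite_type_D_iff_J)
qed

end
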